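(* Let $A$ be a Frobenius algebra over a field $\Bbbk$ with respect to a non-degenerate associative bilinear form $\langle-,-\rangle$, with Nakayama automorphism $\sigma$. The function $$\mathrm{jac}^\sim_\sigma:u\in\mathrm{Aut}(A)\mapsto\mathrm{jac}_\sigma(u^{-1})\in A^\times$$ is a $1$-cocycle on the group $\mathrm{Aut}(A)$ with values in the possibly non-abelian group of units $A^\times$, and its class $\mathfrak{Jac}(A)$ in $H^1(\mathrm{Aut}(A),A^\times)$ depends only on $A$ and not on the choice of the non-degenerate and associative bilinear form $\langle-,-\rangle$ used to compute it.
   Context: $\Bbbk$ is a field; algebras are associative and unital over $\Bbbk$. A Frobenius algebra is a finite-dimensional algebra $A$ endowed with a non-degenerate bilinear form $\langle-,-\rangle:A\times A\to\Bbbk$ that is associative: $\langle ab,c\rangle=\langle a,bc\rangle$ for all $a,b,c\in A$. Its Nakayama automorphism is the unique algebra automorphism $\sigma:A\to A$ such that $\langle a,b\rangle=\langle b,\sigma(a)\rangle$ for all $a,b\in A$. For an algebra endomorphism $u:A\to A$, the Nakayama Jacobian $\mathrm{jac}_\sigma(u)$ is the unique element of $A$ such that $\langle u(a),u(b)\rangle=\langle\mathrm{jac}_\sigma(u)\cdot a,b\rangle$ for all $a,b\in A$; it is a unit of $A$ when $u$ is an automorphism. $\mathrm{Aut}(A)$ is the group of algebra automorphisms of $A$, acting on the group of units $A^\times$ by evaluation. Non-abelian cohomology: for a group $G$ acting on a group $M$ by automorphisms, a $1$-cocycle is a function $f:G\to M$ with $f(gh)=f(g)\cdot g(f(h))$ for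 all $g,h\in G$; two cocycles $f,f'$ are cohomologous if there is $\xi\in M$ with $f'(g)=\xi^{-1}\cdot f(g)\cdot g(\xi)$ for all $g\in G$; $H^1(G,M)$ is the pointed set of cohomology classes, whose trivial element is the class of the constant cocycle $1$. *)

theory Defs
  imports "HOL-Algebra.Algebra" "Jordan_Normal_Form.Missing_VectorSpace"
begin

subsection \<open>Frobenius algebras\<close>

text \<open>The locale \<^locale>\<open>algebra\<close> of HOL-Algebra covers commutative algebras only. As
  \<^locale>\<open>ring\<close> does not require \<open>\<zero> \<noteq> \<one>\<close>, the zero algebra is included below.\<close>

locale unital_algebra = vectorspace K A + Alg: ring A
  for K (structure) and A (structure) +
  assumes smult_mult_left:
      "\<lbrakk>c \<in> carrier K; x \<in> carrier A; y \<in> carrier A\<rbrakk> \<Longrightarrow>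
        (c \<odot>\<^bsub>A\<^esub> x) \<otimes>\<^bsub>A\<^esub> y = c \<odot>\<^bsub>A\<^esub> (x \<otimes>\<^bsub>A\<^esub> y)"
    and smult_mult_right:
      "\<lbrakk>c \<in> carrier K; x \<in> carrier A; y \<in> carrier A\<rbrakk> \<Longrightarrow>
        x \<otimes>\<^bsub>A\<^esub> (c \<odot>\<^bsub>A\<^esub> y) = c \<odot>\<^bsub>A\<^esub> (x \<otimes>\<^bsub>A\<^esub> y)"

locale frobenius_algebra = unital_algebra K A
  for K (structure) and A (structure) +
  fixes form :: "'c \<Rightarrow> 'c \<Rightarrow> 'a"
  assumes finite_dimensional: "fin_dim"
    and form_closed:
      "\<lbrakk>a \<in> carrier A; b \<in> carrier A\<rbrakk> \<Longrightarrow> form a b \<in> carrier K"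
    and form_add_left:
      "\<lbrakk>a \<in> carrier A; a' \<in> carrier A; b \<in> carrier A\<rbrakk> \<Longrightarrow>
        form (a \<oplus>\<^bsub>A\<^esub> a') b = form a b \<oplus>\<^bsub>K\<^esub> form a' b"
    and form_smult_left:
      "\<lbrakk>c \<in> carrier K; a \<in> carrier A; b \<in> carrier A\<rbrakk> \<Longrightarrow>
        form (c \<odot>\<^bsub>A\<^esub> a) b = c \<otimes>\<^bsub>K\<^esub> form a b"
    and form_add_right:
      "\<lbrakk>a \<in> carrier A; b \<in> carrier A; b' \<in> carrier A\<rbrakk> \<Longrightarrow>
        form a (b \<oplus>\<^bsub>A\<^esub> b') = form a b \<oplus>\<^bsub>K\<^esub> form a b'"
    and form_smult_right:
      "\<lbrakk>c \<in> carrier K; a \<in> carrier A; b \<in> carrier A\<rbrakk> \<Longrightarrow>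
        form a (c \<odot>\<^bsub>A\<^esub> b) = c \<otimes>\<^bsub>K\<^esub> form a b"
    and form_nondegenerate_left:
      "\<lbrakk>a \<in> carrier A; \<And>b. b \<in> carrier A \<Longrightarrow> form a b = \<zero>\<^bsub>K\<^esub>\<rbrakk> \<Longrightarrow> a = \<zero>\<^bsub>A\<^esub>"
    and form_nondegenerate_right:
      "\<lbrakk>b \<in> carrier A; \<And>a. a \<in> carrier A \<Longrightarrow> form a b = \<zero>\<^bsub>K\<^esub>\<rbrakk> \<Longrightarrow> b = \<zero>\<^bsub>A\<^esub>"
    and form_assoc:
      "\<lbrakk>a \<in> carrier A; b \<in> carrier A; d \<in> carrier A\<rbrakk> \<Longrightarrow>
        form (a \<otimes>\<^bsub>A\<^esub> b) d = form a (b \<otimes>\<^bsub>A\<^esub> d)"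

text \<open>The Nakayama automorphism is determined by the form and does not occur in the equation
  that characterises the Nakayama Jacobian, so the form alone is the parameter here.\<close>

definition nakayama_jacobian ::
  "('c, 'm) ring_scheme \<Rightarrow> ('c \<Rightarrow> 'c \<Rightarrow> 'a) \<Rightarrow> ('c \<Rightarrow> 'c) \<Rightarrow> 'c"
  where "nakayama_jacobian A form u =
    (THE j. j \<in> carrier A \<and>
      (\<forall>a\<in>carrier A. \<forall>b\<in>carrier A. form (u a) (u b) = form (j \<otimes>\<^bsub>A\<^esub> a) b))"


subsection \<open>The automorphism group and its action on the units\<close>

definition alg_auto ::
  "('a, 'n) ring_scheme \<Rightarrow> ('a, 'c, 'm) module_scheme \<Rightarrow> ('c \<Rightarrow> 'c) set"
  where "alg_auto K A = ring_hom A A \<inter> module_hom K A A \<inter> Bij (carrier A)"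

definition AlgAut ::
  "('a, 'n) ring_scheme \<Rightarrow> ('a, 'c, 'm) module_scheme \<Rightarrow> ('c \<Rightarrow> 'c) monoid"
  where "AlgAut K A = BijGroup (carrier A) \<lparr>carrier := alg_auto K A\<rparr>"

definition units_action :: "('c, 'm) ring_scheme \<Rightarrow> ('c \<Rightarrow> 'c) \<Rightarrow> 'c \<Rightarrow> 'c"
  where "units_action A u = restrict u (Units A)"


subsection \<open>Non-abelian first cohomology\<close>

text \<open>Cocycles are extensional functions on the carrier of \<open>G\<close>, so that equality of cocycles
  is equality on \<open>G\<close>. The action is meant to be a homomorphism \<open>\<phi>\<close> from \<open>G\<close> to
  \<^term>\<open>AutoGroup M\<close>.\<close>

definition cocycles ::
  "('g, 'n) monoid_scheme \<Rightarrow> ('c, 'm) monoid_scheme \<Rightarrow> ('g \<Rightarrow> 'c \<Rightarrow> 'c) \<Rightarrow> ('g \<Rightarrow> 'c) set"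
  where "cocycles G M \<phi> =
    {f \<in> carrier G \<rightarrow>\<^sub>E carrier M.
      \<forall>g\<in>carrier G. \<forall>h\<in>carrier G. f (g \<otimes>\<^bsub>G\<^esub> h) = f g \<otimes>\<^bsub>M\<^esub> \<phi> g (f h)}"

definition cohomologous ::
  "('g, 'n) monoid_scheme \<Rightarrow> ('c, 'm) monoid_scheme \<Rightarrow> ('g \<Rightarrow> 'c \<Rightarrow> 'c) \<Rightarrow>
    (('g \<Rightarrow> 'c) \<times> ('g \<Rightarrow> 'c)) set"
  where "cohomologous G M \<phi> =
    {(f, f'). f \<in> cocycles G M \<phi> \<and> f' \<in> cocycles G M \<phi> \<and>
      (\<exists>\<xi>\<in>carrier M. \<forall>g\<in>carrier G. f' g = inv\<^bsub>M\<^esub> \<xi> \<otimes>\<^bsub>M\<^esub> f g \<otimes>\<^bsub>M\<^esub> \<phi> g \<xi>)}"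

definition H1 ::
  "('g, 'n) monoid_scheme \<Rightarrow> ('c, 'm) monoid_scheme \<Rightarrow> ('g \<Rightarrow> 'c \<Rightarrow> 'c) \<Rightarrow>
    ('g \<Rightarrow> 'c) set set"
  where "H1 G M \<phi> = cocycles G M \<phi> // cohomologous G M \<phi>"

definition cohomology_class ::
  "('g, 'n) monoid_scheme \<Rightarrow> ('c, 'm) monoid_scheme \<Rightarrow> ('g \<Rightarrow> 'c \<Rightarrow> 'c) \<Rightarrow>
    ('g \<Rightarrow> 'c) \<Rightarrow> ('g \<Rightarrow> 'c) set"
  where "cohomology_class G M \<phi> f = cohomologous G M \<phi> `` {f}"


subsection \<open>The Jacobian cocycle and its class\<close>

definition jac_tilde ::
  "('a, 'n) ring_scheme \<Rightarrow> ('a, 'c, 'm) module_scheme \<Rightarrow> ('c \<Rightarrow> 'c \<Rightarrow> 'a) \<Rightarrow>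
    ('c \<Rightarrow> 'c) \<Rightarrow> 'c"
  where "jac_tilde K A form =
    (\<lambda>u\<in>carrier (AlgAut K A). nakayama_jacobian A form (inv\<^bsub>AlgAut K A\<^esub> u))"

definition jac_class ::
  "('a, 'n) ring_scheme \<Rightarrow> ('a, 'c, 'm) module_scheme \<Rightarrow> ('c \<Rightarrow> 'c \<Rightarrow> 'a) \<Rightarrow>
    (('c \<Rightarrow> 'c) \<Rightarrow> 'c) set"
  where "jac_class K A form =
    cohomology_class (AlgAut K A) (units_of A) (units_action A) (jac_tilde K A form)"


subsection \<open>The action is by group automorphisms\<close>

context unital_algebra
begin

lemma alg_auto_inv:
  assumes "u \<in> alg_auto K A"
  shows "restrict (inv_into (carrier A) u) (carrier A) \<in> alg_auto K A"
proof -
  let ?v = "restrict (inv_into (carrier A) u) (carrier A)"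
  have B: "u \<in> Bij (carrier A)" and h: "u \<in> ring_hom A A" and m: "u \<in> module_hom K A A"
    using assms by (auto simp: alg_auto_def)
  have vB: "?v \<in> Bij (carrier A)"
    using restrict_inv_into_Bij[OF B] .
  have bij: "bij_betw u (carrier A) (carrier A)"
    using B by (simp add: Bij_def)
  have uv: "u (?v x) = x" if "x \<in> carrier A" for x
    using that bij by (simp add: bij_betw_inv_into_right)
  have vu: "?v (u x) = x" if "x \<in> carrier A" for x
    using that bij by (simp add: bij_betw_inv_into_left bij_betwE)
  have vc: "?v x \<in> carrier A" if "x \<in> carrier A" for x
    using that Bij_imp_funcset[OF vB] by blast
  have mult: "?v (x \<otimes>\<^bsub>A\<^esub> y) = ?v x \<otimes>\<^bsub>A\<^esub> ?v y"
    if "x \<in> carrier A" "y \<in> carrier A" for x y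
    using vu[OF Alg.m_closed[OF vc vc, OF that]] ring_hom_mult[OF h vc vc, OF that]
      uv[OF that(1)] uv[OF that(2)] by metis
  have add: "?v (x \<oplus>\<^bsub>A\<^esub> y) = ?v x \<oplus>\<^bsub>A\<^esub> ?v y"
    if "x \<in> carrier A" "y \<in> carrier A" for x y
    using vu[OF M.a_closed[OF vc vc, OF that]] ring_hom_add[OF h vc vc, OF that]
      uv[OF that(1)] uv[OF that(2)] by metis
  have one: "?v \<one>\<^bsub>A\<^esub> = \<one>\<^bsub>A\<^esub>"
    using vu ring_hom_one[OF h] by (metis Alg.one_closed)
  have m': "u (c \<odot>\<^bsub>A\<^esub> x) = c \<odot>\<^bsub>A\<^esub> u x" if "c \<in> carrier K" "x \<in> carrier A" for c x
    using m that by (simp add: module_hom_def)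
  have smult: "?v (c \<odot>\<^bsub>A\<^esub> x) = c \<odot>\<^bsub>A\<^esub> ?v x"
    if "c \<in> carrier K" "x \<in> carrier A" for c x
    using vu[OF smult_closed[OF that(1) vc[OF that(2)]]] m'[OF that(1) vc[OF that(2)]]
      uv[OF that(2)] by metis
  have "?v \<in> ring_hom A A"
    by (rule ring_hom_memI[OF vc mult add one])
  moreover have "?v \<in> module_hom K A A"
    unfolding module_hom_def mem_Collect_eq
    by (intro conjI allI impI Pi_I; (elim conjE)?) (erule vc, erule (1) add, erule (1) smult)
  ultimately show ?thesis
    using vB by (simp add: alg_auto_def)
qed

lemma subgroup_alg_auto: "subgroup (alg_auto K A) (BijGroup (carrier A))"
proof (rule subgroup.intro)
  show "alg_auto K A \<subseteq> carrier (BijGroup (carrier A))"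
    by (auto simp: alg_auto_def BijGroup_def)
next
  fix u v assume uv: "u \<in> alg_auto K A" "v \<in> alg_auto K A"
  then have B: "u \<in> Bij (carrier A)" "v \<in> Bij (carrier A)"
    by (auto simp: alg_auto_def)
  have h: "u \<in> ring_hom A A" "v \<in> ring_hom A A"
    using uv by (auto simp: alg_auto_def)
  have c: "v x \<in> carrier A" if "x \<in> carrier A" for x
    using that Bij_imp_funcset[OF B(2)] by blast
  have "compose (carrier A) u v \<in> ring_hom A A"
    by (rule ring_hom_memI)
      (simp_all add: compose_def c ring_hom_closed[OF h(1)] ring_hom_mult[OF h(1)]
        ring_hom_mult[OF h(2)] ring_hom_add[OF h(1)] ring_hom_add[OF h(2)]
        ring_hom_one[OF h(1)] ring_hom_one[OF h(2)])
  moreover have "compose (carrier A) u v \<in> module_hom K A A"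
    using uv by (simp add: alg_auto_def module_hom_def compose_def Pi_iff)
  ultimately show "u \<otimes>\<^bsub>BijGroup (carrier A)\<^esub> v \<in> alg_auto K A"
    using B compose_Bij[OF B] by (simp add: alg_auto_def BijGroup_def)
next
  show "\<one>\<^bsub>BijGroup (carrier A)\<^esub> \<in> alg_auto K A"
    using id_Bij[of "carrier A"]
    by (auto simp: alg_auto_def BijGroup_def ring_hom_def module_hom_def)
next
  fix u assume "u \<in> alg_auto K A"
  then show "inv\<^bsub>BijGroup (carrier A)\<^esub> u \<in> alg_auto K A"
    using alg_auto_inv[of u] inv_BijGroup[of u "carrier A"] by (auto simp: alg_auto_def)
qed

lemma group_AlgAut: "group (AlgAut K A)"
  unfolding AlgAut_def
  using subgroup.subgroup_is_group[OF subgroup_alg_auto group_BijGroup] .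

lemma alg_auto_Units:
  assumes "u \<in> alg_auto K A" "x \<in> Units A"
  shows "u x \<in> Units A"
proof -
  have h: "u \<in> ring_hom A A" using assms by (simp add: alg_auto_def)
  obtain y where y: "y \<in> carrier A" "y \<otimes>\<^bsub>A\<^esub> x = \<one>\<^bsub>A\<^esub>" "x \<otimes>\<^bsub>A\<^esub> y = \<one>\<^bsub>A\<^esub>"
    using assms(2) by (auto simp: Units_def)
  have x: "x \<in> carrier A" using assms(2) by blast
  have "u y \<otimes>\<^bsub>A\<^esub> u x = \<one>\<^bsub>A\<^esub>" "u x \<otimes>\<^bsub>A\<^esub> u y = \<one>\<^bsub>A\<^esub>"
    using x y ring_hom_mult[OF h] ring_hom_one[OF h] by metis+
  then show ?thesis
    using ring_hom_closed[OF h] x y(1) by (auto simp: Units_def)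
qed

lemma units_action_hom: "units_action A \<in> hom (AlgAut K A) (AutoGroup (units_of A))"
proof -
  have act: "units_action A u \<in> auto (units_of A)" if u: "u \<in> alg_auto K A" for u
  proof -
    have h: "u \<in> ring_hom A A" and bij: "bij_betw u (carrier A) (carrier A)"
      using u by (auto simp: alg_auto_def Bij_def)
    have "x \<in> u ` Units A" if x: "x \<in> Units A" for x
    proof (rule image_eqI)
      have xc: "x \<in> carrier A" using x by blast
      show "x = u (inv_into (carrier A) u x)"
        using bij xc by (simp add: bij_betw_inv_into_right)
      show "inv_into (carrier A) u x \<in> Units A"
        using alg_auto_Units[OF alg_auto_inv[OF u] x] xc by simp
    qed
    then have "u ` Units A = Units A"
      using alg_auto_Units[OF u] by blast
    moreover have "inj_on u (Units A)"
      using bij by (meson Alg.Units_closed bij_betw_def inj_on_subset subsetI)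
    ultimately have "bij_betw u (Units A) (Units A)"
      by (simp add: bij_betw_def)
    then have "restrict u (Units A) \<in> Bij (Units A)"
      by (simp add: Bij_def cong: bij_betw_cong)
    moreover have "restrict u (Units A) \<in> hom (units_of A) (units_of A)"
      using alg_auto_Units[OF u] ring_hom_mult[OF h] Alg.Units_closed
      by (simp add: hom_def units_of_def Pi_iff)
    ultimately show ?thesis
      by (simp add: auto_def units_action_def units_of_def)
  qed
  show ?thesis
  proof (rule homI)
    fix u assume "u \<in> carrier (AlgAut K A)"
    then show "units_action A u \<in> carrier (AutoGroup (units_of A))"
      using act by (simp add: AlgAut_def AutoGroup_def)
  next
    fix u v assume "u \<in> carrier (AlgAut K A)" "v \<in> carrier (AlgAut K A)"
    then have uv: "u \<in> alg_auto K A" "v \<in> alg_auto K A"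
      by (simp_all add: AlgAut_def)
    have "u \<in> Bij (carrier A)" "v \<in> Bij (carrier A)"
      using uv by (auto simp: alg_auto_def)
    moreover have "units_action A u \<in> Bij (Units A)" "units_action A v \<in> Bij (Units A)"
      using act uv by (auto simp: auto_def units_of_def)
    ultimately show "units_action A (u \<otimes>\<^bsub>AlgAut K A\<^esub> v) =
        units_action A u \<otimes>\<^bsub>AutoGroup (units_of A)\<^esub> units_action A v"
      using alg_auto_Units[OF uv(2)]
      by (auto simp: AlgAut_def AutoGroup_def BijGroup_def units_action_def units_of_def
          compose_def fun_eq_iff)
  qed
qed

end

end

theory Submission
  imports Defs
begin

text \<open>Associativity gives \<open>\<langle>a, b\<rangle> = \<langle>1, ab\<rangle>\<close>, so the form is determined by the functional
  \<open>\<lambda> = \<langle>1, -\<rangle>\<close>, and non-degeneracy in finite dimension says that every functional is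
  \<open>x \<mapsto> \<lambda>(jx)\<close> for a unique \<open>j\<close>. Thus \<open>jac u\<close> is characterised by \<open>\<lambda>(u x) = \<lambda>(jac u \<cdot> x)\<close>,
  whence \<open>jac (u v) = jac v \<cdot> v\<^sup>-\<^sup>1 (jac u)\<close>, which is the cocycle identity for
  \<open>u \<mapsto> jac (u\<^sup>-\<^sup>1)\<close> and also shows that its values are units. A second form has functional
  \<open>x \<mapsto> \<lambda>(\<xi>x)\<close> with \<open>\<xi>\<close> a unit, and \<open>\<xi>\<close> exhibits the two cocycles as cohomologous.\<close>

section \<open>Injective endomorphisms in finite dimension\<close>

text \<open>\<open>T\<close> carries a finite basis to an independent set of the same cardinality,
  which is then a basis by the dimension count. Its span lies in the image of
  \<open>T\<close>.\<close>

lemma (in vectorspace) inj_endomorphism_surj: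
  assumes fd: "fin_dim" and lin: "linear_map K V V T" and inj: "inj_on T (carrier V)"
  shows "T ` carrier V = carrier V"
proof -
  interpret T: linear_map K V V T by (rule lin)
  obtain B where B: "finite B" "basis B"
    using finite_basis_exists[OF fd] by blast
  have BV: "B \<subseteq> carrier V" and li: "lin_indpt B"
    using B by (auto simp: basis_def)
  have TB: "finite (T ` B)" "T ` B \<subseteq> carrier V"
    using B(1) BV by auto
  \<comment> \<open>Injectivity lets coefficients on the image of \<open>B\<close> be pulled back
    along \<open>T\<close> to coefficients on \<open>B\<close>.\<close>
  have image: "lincomb a (T ` B) = T (lincomb (a \<circ> T) B)" if "a \<in> T ` B \<rightarrow> carrier K" for a
    using T.lincomb_linear_image[OF inj BV that B(1)] .
  have "lin_indpt (T ` B)"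
  proof (rule finite_lin_indpt2[OF TB])
    fix a assume a: "a \<in> T ` B \<rightarrow> carrier K" "lincomb a (T ` B) = \<zero>\<^bsub>V\<^esub>"
    have aT: "a \<circ> T \<in> B \<rightarrow> carrier K" using a(1) by auto
    have "T (lincomb (a \<circ> T) B) = T \<zero>\<^bsub>V\<^esub>"
      by (simp only: image[OF a(1), symmetric] a(2) T.T0_is_0)
    then have "lincomb (a \<circ> T) B = \<zero>\<^bsub>V\<^esub>"
      using inj_onD[OF inj] lincomb_closed[OF BV aT] by blast
    then have "a \<circ> T \<in> B \<rightarrow> {\<zero>\<^bsub>K\<^esub>}"
      using not_lindepD[OF li B(1) subset_refl aT] by blast
    then show "\<forall>v\<in>T ` B. a v = \<zero>\<^bsub>K\<^esub>" by auto
  qed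
  moreover have "dim \<le> card (T ` B)"
    using dim_basis[OF B] card_image[OF inj_on_subset[OF inj BV]] by simp
  ultimately have gen: "span (T ` B) = carrier V"
    using dim_li_is_basis[OF fd TB] by (simp add: basis_def)
  have "v \<in> T ` carrier V" if v: "v \<in> carrier V" for v
  proof -
    obtain a where a: "a \<in> T ` B \<rightarrow> carrier K" "lincomb a (T ` B) = v"
      using finite_in_span[OF TB] v gen by blast
    have "a \<circ> T \<in> B \<rightarrow> carrier K" using a(1) by auto
    then show ?thesis
      using image[OF a(1)] a(2) lincomb_closed[OF BV] by blast
  qed
  then show ?thesis by auto
qed

section \<open>Non-abelian cohomology: classes of cocycles\<close>

text \<open>The witnesses are the unit element for reflexivity, the inverse of \<open>\<xi>\<close>
  for symmetry and the product of \<open>\<xi>\<close> and \<open>\<eta>\<close> for transitivity.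
  They work because each \<open>\<phi> g\<close> is multiplicative.\<close>

lemma equiv_cohomologous:
  assumes "group G" "group M" and act: "\<phi> \<in> hom G (AutoGroup M)"
  shows "equiv (cocycles G M \<phi>) (cohomologous G M \<phi>)"
proof -
  interpret M: group M by fact
  have hom: "\<phi> g \<in> hom M M" if "g \<in> carrier G" for g
    using hom_in_carrier[OF act that] by (simp add: AutoGroup_def BijGroup_def auto_def)
  have closed: "\<phi> g x \<in> carrier M" if "g \<in> carrier G" "x \<in> carrier M" for g x
    using hom_in_carrier[OF hom] that by blast
  have mult: "\<phi> g (x \<otimes>\<^bsub>M\<^esub> y) = \<phi> g x \<otimes>\<^bsub>M\<^esub> \<phi> g y"
    if "g \<in> carrier G" "x \<in> carrier M" "y \<in> carrier M" for g x y
    using hom_mult[OF hom] that by blast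
  have one: "\<phi> g \<one>\<^bsub>M\<^esub> = \<one>\<^bsub>M\<^esub>" if "g \<in> carrier G" for g
    using hom_one[OF hom[OF that]] \<open>group M\<close> by blast
  have value_closed: "f g \<in> carrier M" if "f \<in> cocycles G M \<phi>" "g \<in> carrier G" for f g
    using that by (auto simp: cocycles_def)
  show ?thesis
  proof (rule equivI)
    show "cohomologous G M \<phi> \<subseteq> cocycles G M \<phi> \<times> cocycles G M \<phi>"
      by (auto simp: cohomologous_def)
  next
    show "refl_on (cocycles G M \<phi>) (cohomologous G M \<phi>)"
    proof (rule refl_onI)
      fix f assume f: "f \<in> cocycles G M \<phi>"
      then have "\<forall>g\<in>carrier G. f g = inv\<^bsub>M\<^esub> \<one>\<^bsub>M\<^esub> \<otimes>\<^bsub>M\<^esub> f g \<otimes>\<^bsub>M\<^esub> \<phi> g \<one>\<^bsub>M\<^esub>"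
        by (simp add: one value_closed)
      then show "(f, f) \<in> cohomologous G M \<phi>"
        using f M.one_closed unfolding cohomologous_def by blast
    qed
  next
    show "sym (cohomologous G M \<phi>)"
    proof (rule symI)
      fix f f' assume "(f, f') \<in> cohomologous G M \<phi>"
      then obtain \<xi> where f: "f \<in> cocycles G M \<phi>" "f' \<in> cocycles G M \<phi>" and \<xi>: "\<xi> \<in> carrier M"
        and eq: "\<And>g. g \<in> carrier G \<Longrightarrow> f' g = inv\<^bsub>M\<^esub> \<xi> \<otimes>\<^bsub>M\<^esub> f g \<otimes>\<^bsub>M\<^esub> \<phi> g \<xi>"
        by (auto simp: cohomologous_def)
      have "f g = inv\<^bsub>M\<^esub> (inv\<^bsub>M\<^esub> \<xi>) \<otimes>\<^bsub>M\<^esub> f' g \<otimes>\<^bsub>M\<^esub> \<phi> g (inv\<^bsub>M\<^esub> \<xi>)" if g: "g \<in> carrier G" for g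
      proof -
        have inv: "\<phi> g \<xi> \<otimes>\<^bsub>M\<^esub> \<phi> g (inv\<^bsub>M\<^esub> \<xi>) = \<one>\<^bsub>M\<^esub>"
          using mult[OF g \<xi> M.inv_closed[OF \<xi>]] one[OF g] \<xi> by simp
        \<comment> \<open>The simplifier nests products to the right, which separates
          \<open>\<xi>\<close> from its inverse; this is the cancellation law in that shape.\<close>
        have cancel: "\<xi> \<otimes>\<^bsub>M\<^esub> (inv\<^bsub>M\<^esub> \<xi> \<otimes>\<^bsub>M\<^esub> y) = y" if "y \<in> carrier M" for y
          using that \<xi> by (simp add: M.m_assoc[symmetric])
        show ?thesis
          using g \<xi> f by (simp add: eq M.m_assoc closed value_closed inv cancel)
      qed
      then show "(f', f) \<in> cohomologous G M \<phi>"
        using f M.inv_closed[OF \<xi>] unfolding cohomologous_def by blast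
    qed
  next
    show "trans (cohomologous G M \<phi>)"
    proof (rule transI)
      fix f f' f'' assume "(f, f') \<in> cohomologous G M \<phi>" "(f', f'') \<in> cohomologous G M \<phi>"
      then obtain \<xi> \<eta> where f: "f \<in> cocycles G M \<phi>" "f'' \<in> cocycles G M \<phi>"
        and \<xi>: "\<xi> \<in> carrier M" and \<eta>: "\<eta> \<in> carrier M"
        and eq: "\<And>g. g \<in> carrier G \<Longrightarrow> f' g = inv\<^bsub>M\<^esub> \<xi> \<otimes>\<^bsub>M\<^esub> f g \<otimes>\<^bsub>M\<^esub> \<phi> g \<xi>"
        and eq': "\<And>g. g \<in> carrier G \<Longrightarrow> f'' g = inv\<^bsub>M\<^esub> \<eta> \<otimes>\<^bsub>M\<^esub> f' g \<otimes>\<^bsub>M\<^esub> \<phi> g \<eta>"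
        by (auto simp: cohomologous_def)
      have "f'' g = inv\<^bsub>M\<^esub> (\<xi> \<otimes>\<^bsub>M\<^esub> \<eta>) \<otimes>\<^bsub>M\<^esub> f g \<otimes>\<^bsub>M\<^esub> \<phi> g (\<xi> \<otimes>\<^bsub>M\<^esub> \<eta>)" if g: "g \<in> carrier G" for g
        using g \<xi> \<eta> f(1)
        by (simp add: eq eq' M.inv_mult_group mult M.m_assoc closed value_closed)
      then show "(f, f'') \<in> cohomologous G M \<phi>"
        using f M.m_closed[OF \<xi> \<eta>] unfolding cohomologous_def by blast
    qed
  qed
qed

lemma (in unital_algebra) equiv_cohomologous_units:
  "equiv (cocycles (AlgAut K A) (units_of A) (units_action A))
    (cohomologous (AlgAut K A) (units_of A) (units_action A))"
  by (rule equiv_cohomologous[OF group_AlgAut Alg.units_group units_action_hom])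

section \<open>Functionals represented by the form\<close>

context frobenius_algebra
begin

lemma form_one:
  assumes "a \<in> carrier A" "b \<in> carrier A"
  shows "form \<one>\<^bsub>A\<^esub> (a \<otimes>\<^bsub>A\<^esub> b) = form a b"
  using form_assoc[OF Alg.one_closed assms] assms by simp

text \<open>Left non-degeneracy applied to the difference of \<open>a\<close> and \<open>a'\<close>.
  The uniqueness arguments for representing elements and Jacobians rest on it.\<close>

lemma form_left_cancel:
  assumes a: "a \<in> carrier A" "a' \<in> carrier A"
    and eq: "\<And>x. x \<in> carrier A \<Longrightarrow> form a x = form a' x"
  shows "a = a'"
proof -
  have "form (a \<ominus>\<^bsub>A\<^esub> a') x = \<zero>\<^bsub>K\<^esub>" if x: "x \<in> carrier A" for x
  proof -
    \<comment> \<open>Additivity speaks of sums, so \<open>form a' x\<close> is added back and then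
      cancelled.\<close>
    have "form (a \<ominus>\<^bsub>A\<^esub> a') x \<oplus>\<^bsub>K\<^esub> form a' x = form (a \<ominus>\<^bsub>A\<^esub> a' \<oplus>\<^bsub>A\<^esub> a') x"
      using a x form_add_left by simp
    also have "a \<ominus>\<^bsub>A\<^esub> a' \<oplus>\<^bsub>A\<^esub> a' = a"
      using a by (simp add: a_minus_def M.a_assoc M.l_neg)
    finally show ?thesis
      using eq[OF x] form_closed a x R.add.r_cancel_one by simp
  qed
  then have "a \<ominus>\<^bsub>A\<^esub> a' = \<zero>\<^bsub>A\<^esub>"
    using form_nondegenerate_left a by simp
  then show ?thesis using a by simp
qed

lemma functional_representable:
  assumes closed: "\<And>x. x \<in> carrier A \<Longrightarrow> \<mu> x \<in> carrier K"
    and add: "\<And>x y. \<lbrakk>x \<in> carrier A; y \<in> carrier A\<rbrakk> \<Longrightarrow> \<mu> (x \<oplus>\<^bsub>A\<^esub> y) = \<mu> x \<oplus>\<^bsub>K\<^esub> \<mu> y"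
    and smult: "\<And>c x. \<lbrakk>c \<in> carrier K; x \<in> carrier A\<rbrakk> \<Longrightarrow> \<mu> (c \<odot>\<^bsub>A\<^esub> x) = c \<otimes>\<^bsub>K\<^esub> \<mu> x"
  shows "\<exists>j\<in>carrier A. \<forall>x\<in>carrier A. \<mu> x = form j x"
proof -
  obtain B where B: "finite B" "basis B"
    using finite_basis_exists[OF finite_dimensional] by blast
  have BA: "B \<subseteq> carrier A" and li: "lin_indpt B" and gen: "span B = carrier A"
    using B by (auto simp: basis_def)
  \<comment> \<open>The set on which two linear functionals agree is a submodule, so it contains the
    span of \<open>B\<close>. This serves both the injectivity of \<open>T\<close> and the final
    identification of \<open>\<mu>\<close>.\<close>
  have agree: "\<nu> x = form a x"
    if \<nu>: "\<And>x. x \<in> carrier A \<Longrightarrow> \<nu> x \<in> carrier K"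
      "\<And>x y. \<lbrakk>x \<in> carrier A; y \<in> carrier A\<rbrakk> \<Longrightarrow> \<nu> (x \<oplus>\<^bsub>A\<^esub> y) = \<nu> x \<oplus>\<^bsub>K\<^esub> \<nu> y"
      "\<And>c x. \<lbrakk>c \<in> carrier K; x \<in> carrier A\<rbrakk> \<Longrightarrow> \<nu> (c \<odot>\<^bsub>A\<^esub> x) = c \<otimes>\<^bsub>K\<^esub> \<nu> x"
      and a: "a \<in> carrier A" and on_B: "\<And>b. b \<in> B \<Longrightarrow> \<nu> b = form a b"
      and x: "x \<in> carrier A" for \<nu> a x
  proof -
    let ?N = "{x \<in> carrier A. \<nu> x = form a x}"
    have zero: "\<nu> \<zero>\<^bsub>A\<^esub> = form a \<zero>\<^bsub>A\<^esub>"
      using \<nu>(3)[of "\<zero>\<^bsub>K\<^esub>" "\<zero>\<^bsub>A\<^esub>"] form_smult_right[of "\<zero>\<^bsub>K\<^esub>" a "\<zero>\<^bsub>A\<^esub>"]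
      by (simp add: \<nu>(1) a form_closed)
    have "submodule K ?N A"
    proof (rule submodule.intro)
      show "module K A" by (rule module_axioms)
    qed (auto simp: zero a \<nu>(2,3) form_add_right form_smult_right)
    then have "span B \<subseteq> ?N"
      using span_is_subset[of B ?N] on_B BA by blast
    then show ?thesis using gen x by blast
  qed
  \<comment> \<open>Linear independence of \<open>B\<close>, applied to the difference of the two
    coefficient functions.\<close>
  have coeff_eq: "c b = d b"
    if c: "c \<in> B \<rightarrow> carrier K" and d: "d \<in> B \<rightarrow> carrier K"
      and eq: "lincomb c B = lincomb d B" and b: "b \<in> B" for c d b
  proof -
    have zero: "lincomb (\<lambda>v. c v \<ominus>\<^bsub>K\<^esub> d v) B = \<zero>\<^bsub>A\<^esub>"
      unfolding lincomb_diff[OF B(1) BA c d] eq a_minus_def[of A]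
      by (rule M.r_neg[OF lincomb_closed[OF BA d]])
    have "(\<lambda>v. c v \<ominus>\<^bsub>K\<^esub> d v) \<in> B \<rightarrow> carrier K" using c d by auto
    from not_lindepD[OF li B(1) subset_refl this zero] have "c b \<ominus>\<^bsub>K\<^esub> d b = \<zero>\<^bsub>K\<^esub>"
      using b by auto
    then show ?thesis using c d b by (simp add: Pi_iff)
  qed
  \<comment> \<open>\<open>T\<close> is the map from \<open>a\<close> to the functional
    \<open>form a\<close>, followed by the identification of the dual of \<open>A\<close> with
    \<open>A\<close> through values on \<open>B\<close>. As an endomorphism of \<open>A\<close> it
    is surjective once it is injective, and a preimage of the vector with coefficients
    \<open>\<mu>\<close> is the desired \<open>j\<close>.\<close>
  define T where "T a = lincomb (form a) B" for a
  have fB: "form a \<in> B \<rightarrow> carrier K" if "a \<in> carrier A" for a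
    using that form_closed BA by auto
  have T_closed: "T a \<in> carrier A" if "a \<in> carrier A" for a
    unfolding T_def using lincomb_closed[OF BA fB[OF that]] .
  have T_add: "T (a \<oplus>\<^bsub>A\<^esub> a') = T a \<oplus>\<^bsub>A\<^esub> T a'" if "a \<in> carrier A" "a' \<in> carrier A" for a a'
  proof -
    have "T (a \<oplus>\<^bsub>A\<^esub> a') = lincomb (\<lambda>b. form a b \<oplus>\<^bsub>K\<^esub> form a' b) B"
      unfolding T_def
      by (rule lincomb_cong[OF refl BA])
        (use that BA in \<open>simp_all add: form_add_left form_closed subset_iff\<close>)
    then show ?thesis
      unfolding T_def using lincomb_sum[OF B(1) BA fB fB] that by simp
  qed
  have T_smult: "T (c \<odot>\<^bsub>A\<^esub> a) = c \<odot>\<^bsub>A\<^esub> T a" if "c \<in> carrier K" "a \<in> carrier A" for c a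
  proof -
    have "T (c \<odot>\<^bsub>A\<^esub> a) = lincomb (\<lambda>b. c \<otimes>\<^bsub>K\<^esub> form a b) B"
      unfolding T_def
      by (rule lincomb_cong[OF refl BA])
        (use that BA in \<open>simp_all add: form_smult_left form_closed subset_iff\<close>)
    then show ?thesis
      unfolding T_def using lincomb_smult[OF BA fB] that by simp
  qed
  have vs: "vectorspace K A" by (rule vectorspace_axioms)
  have "T \<in> module_hom K A A"
    unfolding module_hom_def using T_closed T_add T_smult by auto
  then have "linear_map K A A T"
    by (intro linear_map.intro mod_hom.intro mod_hom_axioms.intro vs module_axioms)
  moreover have "inj_on T (carrier A)"
  proof (rule inj_onI)
    \<comment> \<open>Equal images give equal coefficients, hence functionals that agree on
      \<open>B\<close>, then on all of \<open>A\<close>, and left cancellation applies.\<close>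
    fix a a' assume a: "a \<in> carrier A" "a' \<in> carrier A" and eq: "T a = T a'"
    have on_B: "form a b = form a' b" if "b \<in> B" for b
      by (rule coeff_eq[OF fB[OF a(1)] fB[OF a(2)] eq[unfolded T_def] that])
    show "a = a'"
    proof (rule form_left_cancel[OF a])
      fix x assume "x \<in> carrier A"
      then show "form a x = form a' x"
        by (rule agree[of "form a", rotated -1])
          (simp_all add: a on_B form_closed form_add_right form_smult_right)
    qed
  qed
  ultimately have surj: "T ` carrier A = carrier A"
    using inj_endomorphism_surj[OF finite_dimensional] by blast
  have \<mu>B: "\<mu> \<in> B \<rightarrow> carrier K" using closed BA by auto
  obtain j where j: "j \<in> carrier A" "lincomb \<mu> B = T j"
    using surj lincomb_closed[OF BA \<mu>B] by blast
  have on_B: "\<mu> b = form j b" if "b \<in> B" for b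
    by (rule coeff_eq[OF \<mu>B fB[OF j(1)] j(2)[unfolded T_def] that])
  have "\<mu> x = form j x" if "x \<in> carrier A" for x
    by (rule agree[OF closed add smult j(1) on_B that])
  then show ?thesis using j(1) by blast
qed

section \<open>The Nakayama Jacobian of an automorphism\<close>

text \<open>Since \<open>u\<close> is multiplicative and preserves the unit, the two-variable
  defining equation is equivalent to its instance with first argument one.\<close>

lemma nakayama_jacobian_eqI:
  assumes u: "u \<in> alg_auto K A" and j: "j \<in> carrier A"
    and eq: "\<And>x. x \<in> carrier A \<Longrightarrow> form \<one>\<^bsub>A\<^esub> (u x) = form j x"
  shows "nakayama_jacobian A form u = j"
proof -
  have h: "u \<in> ring_hom A A" using u by (simp add: alg_auto_def)
  show ?thesis
    unfolding nakayama_jacobian_def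
  proof (rule the_equality, intro conjI ballI j)
    fix a b assume ab: "a \<in> carrier A" "b \<in> carrier A"
    have "form (u a) (u b) = form \<one>\<^bsub>A\<^esub> (u (a \<otimes>\<^bsub>A\<^esub> b))"
      using form_one ring_hom_closed[OF h] ring_hom_mult[OF h] ab by simp
    then show "form (u a) (u b) = form (j \<otimes>\<^bsub>A\<^esub> a) b"
      using eq[of "a \<otimes>\<^bsub>A\<^esub> b"] form_assoc j ab by simp
  next
    fix i assume i: "i \<in> carrier A \<and>
      (\<forall>a\<in>carrier A. \<forall>b\<in>carrier A. form (u a) (u b) = form (i \<otimes>\<^bsub>A\<^esub> a) b)"
    show "i = j"
    proof (rule form_left_cancel)
      fix x assume x: "x \<in> carrier A"
      show "form i x = form j x"
        using i x eq[OF x] ring_hom_one[OF h] by (metis Alg.one_closed Alg.r_one)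
    qed (use i j in auto)
  qed
qed

lemma nakayama_jacobian:
  assumes u: "u \<in> alg_auto K A"
  shows nakayama_jacobian_closed: "nakayama_jacobian A form u \<in> carrier A"
    and form_nakayama_jacobian:
      "\<And>x. x \<in> carrier A \<Longrightarrow> form \<one>\<^bsub>A\<^esub> (u x) = form (nakayama_jacobian A form u) x"
proof -
  have h: "u \<in> ring_hom A A" and m: "u \<in> module_hom K A A"
    using u by (auto simp: alg_auto_def)
  have "\<exists>j\<in>carrier A. \<forall>x\<in>carrier A. form \<one>\<^bsub>A\<^esub> (u x) = form j x"
    by (rule functional_representable)
      (simp_all add: form_closed form_add_right form_smult_right ring_hom_closed[OF h]
        ring_hom_add[OF h] module_hom_smult[OF m])
  then obtain j where j: "j \<in> carrier A" "\<And>x. x \<in> carrier A \<Longrightarrow> form \<one>\<^bsub>A\<^esub> (u x) = form j x"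
    by blast
  then have "nakayama_jacobian A form u = j"
    using nakayama_jacobian_eqI[OF u] by blast
  then show "nakayama_jacobian A form u \<in> carrier A"
    and "\<And>x. x \<in> carrier A \<Longrightarrow> form \<one>\<^bsub>A\<^esub> (u x) = form (nakayama_jacobian A form u) x"
    using j by auto
qed

section \<open>The cocycle of inverse Jacobians\<close>

lemma jac_tilde_closed:
  assumes "g \<in> carrier (AlgAut K A)"
  shows "jac_tilde K A form g \<in> carrier A"
  using assms group.inv_closed[OF group_AlgAut assms] nakayama_jacobian_closed
  by (simp add: jac_tilde_def AlgAut_def)

lemma AlgAut_inv_apply:
  assumes g: "g \<in> carrier (AlgAut K A)" and x: "x \<in> carrier A"
  shows "g ((inv\<^bsub>AlgAut K A\<^esub> g) x) = x"
proof -
  have "(g \<otimes>\<^bsub>AlgAut K A\<^esub> inv\<^bsub>AlgAut K A\<^esub> g) x = x"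
    using group.r_inv[OF group_AlgAut g] x by (simp add: AlgAut_def BijGroup_def)
  then show ?thesis
    using g group.inv_closed[OF group_AlgAut g] x
    by (simp add: AlgAut_def BijGroup_def alg_auto_def compose_def)
qed

text \<open>The characterisation of \<open>jac (g\<^sup>-\<^sup>1)\<close> with \<open>x\<close> replaced by \<open>g x\<close>, so that no inverse occurs.\<close>

lemma form_jac_tilde:
  assumes g: "g \<in> carrier (AlgAut K A)" and x: "x \<in> carrier A"
  shows "form (jac_tilde K A form g) (g x) = form \<one>\<^bsub>A\<^esub> x"
proof -
  let ?v = "inv\<^bsub>AlgAut K A\<^esub> g"
  have v: "?v \<in> carrier (AlgAut K A)"
    using group.inv_closed[OF group_AlgAut g] .
  have gx: "g x \<in> carrier A"
    using g x ring_hom_closed by (fastforce simp: AlgAut_def alg_auto_def)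
  have "?v (g x) = x"
    using AlgAut_inv_apply[OF v x] group.inv_inv[OF group_AlgAut g] by simp
  then show ?thesis
    using form_nakayama_jacobian[of ?v "g x"] v g gx by (simp add: jac_tilde_def AlgAut_def)
qed

text \<open>Every \<open>y\<close> has the form \<open>g x\<close> with \<open>x\<close> the image
  of \<open>y\<close> under the inverse of \<open>g\<close>, so the equation determines the
  functional \<open>form j\<close> completely.\<close>

lemma jac_tilde_eqI:
  assumes g: "g \<in> carrier (AlgAut K A)" and j: "j \<in> carrier A"
    and eq: "\<And>x. x \<in> carrier A \<Longrightarrow> form j (g x) = form \<one>\<^bsub>A\<^esub> x"
  shows "jac_tilde K A form g = j"
proof (rule form_left_cancel[OF jac_tilde_closed[OF g] j])
  fix y assume y: "y \<in> carrier A"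
  have "(inv\<^bsub>AlgAut K A\<^esub> g) y \<in> carrier A"
    using group.inv_closed[OF group_AlgAut g] y ring_hom_closed
    by (fastforce simp: AlgAut_def alg_auto_def)
  then show "form (jac_tilde K A form g) y = form j y"
    using form_jac_tilde[OF g] eq AlgAut_inv_apply[OF g y] by metis
qed

text \<open>It suffices to test the product against \<open>g (h x)\<close>. Multiplicativity of
  \<open>g\<close> collects everything after the first factor under \<open>g\<close>, and the
  characterisations for \<open>g\<close> and then \<open>h\<close> apply in turn.\<close>

lemma jac_tilde_mult:
  assumes g: "g \<in> carrier (AlgAut K A)" and h: "h \<in> carrier (AlgAut K A)"
  shows "jac_tilde K A form (g \<otimes>\<^bsub>AlgAut K A\<^esub> h) =
    jac_tilde K A form g \<otimes>\<^bsub>A\<^esub> g (jac_tilde K A form h)"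
proof (rule jac_tilde_eqI)
  interpret Aut: group "AlgAut K A" by (rule group_AlgAut)
  have gh: "g \<in> ring_hom A A" "h \<in> ring_hom A A"
    using g h by (auto simp: AlgAut_def alg_auto_def)
  note closed = jac_tilde_closed[OF g] jac_tilde_closed[OF h]
    ring_hom_closed[OF gh(1)] ring_hom_closed[OF gh(2)]
  show "g \<otimes>\<^bsub>AlgAut K A\<^esub> h \<in> carrier (AlgAut K A)" using g h by simp
  show "jac_tilde K A form g \<otimes>\<^bsub>A\<^esub> g (jac_tilde K A form h) \<in> carrier A"
    using closed by simp
  fix x assume x: "x \<in> carrier A"
  have app: "(g \<otimes>\<^bsub>AlgAut K A\<^esub> h) x = g (h x)"
    using g h x by (simp add: AlgAut_def BijGroup_def alg_auto_def compose_def)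
  have "form (jac_tilde K A form g \<otimes>\<^bsub>A\<^esub> g (jac_tilde K A form h)) (g (h x))
      = form (jac_tilde K A form g) (g (jac_tilde K A form h \<otimes>\<^bsub>A\<^esub> h x))"
    using closed x form_assoc ring_hom_mult[OF gh(1)] by simp
  also have "\<dots> = form \<one>\<^bsub>A\<^esub> (jac_tilde K A form h \<otimes>\<^bsub>A\<^esub> h x)"
    using form_jac_tilde[OF g] closed x by simp
  also have "\<dots> = form \<one>\<^bsub>A\<^esub> x"
    using form_one form_jac_tilde[OF h x] closed x by simp
  finally show "form (jac_tilde K A form g \<otimes>\<^bsub>A\<^esub> g (jac_tilde K A form h))
      ((g \<otimes>\<^bsub>AlgAut K A\<^esub> h) x) = form \<one>\<^bsub>A\<^esub> x"
    by (simp only: app)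
qed

text \<open>The product formula for \<open>g\<close> and its inverse gives a right inverse of the
  value at \<open>g\<close>. With the factors in the other order it gives an equation that
  \<open>g\<close> transports to the left inverse law for the same element.\<close>

lemma jac_tilde_Units:
  assumes g: "g \<in> carrier (AlgAut K A)"
  shows "jac_tilde K A form g \<in> Units A"
proof -
  interpret Aut: group "AlgAut K A" by (rule group_AlgAut)
  let ?f = "jac_tilde K A form" and ?v = "inv\<^bsub>AlgAut K A\<^esub> g"
  have v: "?v \<in> carrier (AlgAut K A)" using g by simp
  have h: "g \<in> ring_hom A A" using g by (simp add: AlgAut_def alg_auto_def)
  have one: "?f \<one>\<^bsub>AlgAut K A\<^esub> = \<one>\<^bsub>A\<^esub>"
    by (rule jac_tilde_eqI) (simp_all, simp add: AlgAut_def BijGroup_def)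
  have right: "?f g \<otimes>\<^bsub>A\<^esub> g (?f ?v) = \<one>\<^bsub>A\<^esub>"
    using jac_tilde_mult[OF g v] g one by simp
  have vf: "?v (?f g) \<in> carrier A"
    using v jac_tilde_closed[OF g] ring_hom_closed by (fastforce simp: AlgAut_def alg_auto_def)
  have "?f ?v \<otimes>\<^bsub>A\<^esub> ?v (?f g) = \<one>\<^bsub>A\<^esub>"
    using jac_tilde_mult[OF v g] g one by simp
  then have "g (?f ?v) \<otimes>\<^bsub>A\<^esub> ?f g = \<one>\<^bsub>A\<^esub>"
    using ring_hom_mult[OF h jac_tilde_closed[OF v] vf] ring_hom_one[OF h]
      AlgAut_inv_apply[OF g jac_tilde_closed[OF g]] by simp
  then show ?thesis
    using right jac_tilde_closed[OF g] ring_hom_closed[OF h jac_tilde_closed[OF v]]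
    by (auto simp: Units_def)
qed

text \<open>The values are units, so the restriction in \<open>units_action\<close> leaves
  \<open>g\<close> unchanged on them and the product formula becomes the cocycle law.\<close>

lemma jac_tilde_cocycle:
  "jac_tilde K A form \<in> cocycles (AlgAut K A) (units_of A) (units_action A)"
proof -
  have "jac_tilde K A form \<in> extensional (carrier (AlgAut K A))"
    by (simp add: jac_tilde_def)
  then show ?thesis
    using jac_tilde_Units jac_tilde_mult
    by (auto simp: cocycles_def units_of_def units_action_def PiE_iff)
qed

section \<open>Independence of the form\<close>

lemma jac_tilde_cohomologous:
  assumes "frobenius_algebra K A form'"
  shows "(jac_tilde K A form, jac_tilde K A form') \<in>
    cohomologous (AlgAut K A) (units_of A) (units_action A)"
proof -
  interpret F': frobenius_algebra K A form' by fact
  \<comment> \<open>\<open>\<xi>\<close> represents the functional of \<open>form'\<close> through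
    \<open>form\<close>, and \<open>\<eta>\<close> that of \<open>form\<close> through
    \<open>form'\<close>. Taking both makes the inverse of \<open>\<xi>\<close> explicit.\<close>
  obtain \<xi> where \<xi>: "\<xi> \<in> carrier A" and \<xi>_eq: "\<And>x. x \<in> carrier A \<Longrightarrow> form' \<one>\<^bsub>A\<^esub> x = form \<xi> x"
    using functional_representable[of "form' \<one>\<^bsub>A\<^esub>"]
      F'.form_closed F'.form_add_right F'.form_smult_right by auto
  obtain \<eta> where \<eta>: "\<eta> \<in> carrier A" and \<eta>_eq: "\<And>x. x \<in> carrier A \<Longrightarrow> form \<one>\<^bsub>A\<^esub> x = form' \<eta> x"
    using F'.functional_representable[of "form \<one>\<^bsub>A\<^esub>"]
      form_closed form_add_right form_smult_right by auto
  have form'_eq: "form' a x = form (\<xi> \<otimes>\<^bsub>A\<^esub> a) x" if "a \<in> carrier A" "x \<in> carrier A" for a x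
    using F'.form_one \<xi>_eq[of "a \<otimes>\<^bsub>A\<^esub> x"] form_assoc \<xi> that by simp
  have form_eq: "form a x = form' (\<eta> \<otimes>\<^bsub>A\<^esub> a) x" if "a \<in> carrier A" "x \<in> carrier A" for a x
    using form_one \<eta>_eq[of "a \<otimes>\<^bsub>A\<^esub> x"] F'.form_assoc \<eta> that by simp
  \<comment> \<open>Converting to the other form and back changes nothing, so the product represents
    the same functional as the unit element.\<close>
  have \<xi>\<eta>: "\<xi> \<otimes>\<^bsub>A\<^esub> \<eta> = \<one>\<^bsub>A\<^esub>"
    by (rule form_left_cancel) (use \<xi> \<eta> \<eta>_eq form'_eq in auto)
  have \<eta>\<xi>: "\<eta> \<otimes>\<^bsub>A\<^esub> \<xi> = \<one>\<^bsub>A\<^esub>"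
    by (rule F'.form_left_cancel) (use \<xi> \<eta> \<xi>_eq form_eq in auto)
  have unit: "\<xi> \<in> Units A"
    using \<xi> \<eta> \<xi>\<eta> \<eta>\<xi> by (auto simp: Units_def)
  have inv: "inv\<^bsub>units_of A\<^esub> \<xi> = \<eta>"
    using Alg.units_of_inv[OF unit] Alg.inv_unique'[OF \<xi> \<eta> \<xi>\<eta> \<eta>\<xi>] by simp
  have "jac_tilde K A form' g = \<eta> \<otimes>\<^bsub>A\<^esub> jac_tilde K A form g \<otimes>\<^bsub>A\<^esub> g \<xi>"
    if g: "g \<in> carrier (AlgAut K A)" for g
  proof (rule F'.jac_tilde_eqI[OF g])
    have h: "g \<in> ring_hom A A" using g by (simp add: AlgAut_def alg_auto_def)
    note closed = jac_tilde_closed[OF g] ring_hom_closed[OF h] \<xi> \<eta>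
    show "\<eta> \<otimes>\<^bsub>A\<^esub> jac_tilde K A form g \<otimes>\<^bsub>A\<^esub> g \<xi> \<in> carrier A"
      using closed by simp
    fix x assume x: "x \<in> carrier A"
    \<comment> \<open>The factor \<open>\<eta>\<close> turns \<open>form'\<close> into
      \<open>form\<close>; \<open>g \<xi>\<close> is then absorbed with \<open>g x\<close> under
      \<open>g\<close>, and once \<open>g\<close> is removed \<open>\<xi>\<close> turns
      \<open>form\<close> back into \<open>form'\<close>.\<close>
    have "form' (\<eta> \<otimes>\<^bsub>A\<^esub> jac_tilde K A form g \<otimes>\<^bsub>A\<^esub> g \<xi>) (g x)
        = form (jac_tilde K A form g \<otimes>\<^bsub>A\<^esub> g \<xi>) (g x)"
      using form_eq[of "jac_tilde K A form g \<otimes>\<^bsub>A\<^esub> g \<xi>" "g x"] closed x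
      by (simp add: Alg.m_assoc)
    also have "\<dots> = form (jac_tilde K A form g) (g (\<xi> \<otimes>\<^bsub>A\<^esub> x))"
      using closed x form_assoc ring_hom_mult[OF h] by simp
    also have "\<dots> = form \<one>\<^bsub>A\<^esub> (\<xi> \<otimes>\<^bsub>A\<^esub> x)"
      using form_jac_tilde[OF g] closed x by simp
    also have "\<dots> = form' \<one>\<^bsub>A\<^esub> x"
      using form_one \<xi>_eq \<xi> x by simp
    finally show "form' (\<eta> \<otimes>\<^bsub>A\<^esub> jac_tilde K A form g \<otimes>\<^bsub>A\<^esub> g \<xi>) (g x) = form' \<one>\<^bsub>A\<^esub> x" .
  qed
  then have "\<forall>g\<in>carrier (AlgAut K A). jac_tilde K A form' g =
      inv\<^bsub>units_of A\<^esub> \<xi> \<otimes>\<^bsub>units_of A\<^esub> jac_tilde K A form g \<otimes>\<^bsub>units_of A\<^esub> units_action A g \<xi>"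
    using unit inv by (simp add: units_action_def units_of_mult)
  then show ?thesis
    using jac_tilde_cocycle F'.jac_tilde_cocycle unit
    by (auto simp: cohomologous_def units_of_carrier)
qed

end

theorem proposition4:
  fixes K :: "('a, 'n) ring_scheme" and A :: "('a, 'c, 'm) module_scheme"
    and form :: "'c \<Rightarrow> 'c \<Rightarrow> 'a"
  assumes "frobenius_algebra K A form"
  shows "jac_tilde K A form \<in> cocycles (AlgAut K A) (units_of A) (units_action A) \<and>
    jac_class K A form \<in> H1 (AlgAut K A) (units_of A) (units_action A) \<and>
    (\<forall>form'. frobenius_algebra K A form' \<longrightarrow> jac_class K A form' = jac_class K A form)"
proof -
  interpret frobenius_algebra K A form by fact
  have "jac_class K A form \<in> H1 (AlgAut K A) (units_of A) (units_action A)"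
    unfolding jac_class_def H1_def cohomology_class_def
    by (rule quotientI[OF jac_tilde_cocycle])
  moreover have "jac_class K A form' = jac_class K A form"
    if "frobenius_algebra K A form'" for form'
    unfolding jac_class_def cohomology_class_def
    by (rule equiv_class_eq[OF equiv_cohomologous_units jac_tilde_cohomologous[OF that], symmetric])
  ultimately show ?thesis
    using jac_tilde_cocycle by blast
qed

end
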